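(* Let $H$ be an arbitrary fixed hypergraph, and let $\mathcal{J}$ be the family of all strong subgraphs of $H$. Let $M\in\mathbb{N}$ and let $\mathbf{p}=(p_r)_{r=1}^M$ be an $M$-bounded sequence (i.e. $0\le p_r=p_r(n)\le 1$ for $r\in[M]$ and $p_r=0$ for $r>M$). For $r\in[M]$ let $$p'_r = p_r + n p_{r+1} + n^2 p_{r+2} + \dots + n^{M-r}p_M,$$ and for a hypergraph $H'$ let $$\mu_w(H') = n^{v(H')}\prod_{r=1}^M (p'_r)^{e_r(H')}.$$ \begin{itemize} \item[(a)] If for some $H'\in\mathcal{J}$ we have $\mu_w(H')\to 0$ as $n\to\infty$, then a.a.s. $\mathscr{H}(n,\mathbf{p})$ does not contain $H$ as a weak subgraph. \item[(b)] If for all $H'\in\mathcal{J}$ we have $\mu_w(H')\to\infty$ as $n\to\infty$, then a.a.s. $\mathscr{H}(n,\mathbf{p})$ contains $H$ as a weak subgraph. \end{itemize}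
   Context: A hypergraph is a pair $H=(V,E)$ with $V$ a finite set and $E$ a family of subsets of $V$ (edges). $v(H)=|V|$, and $e_r(H)$ is the number of edges of size $r$. The random hypergraph $\mathscr{H}(n,\mathbf{p})$ has vertex set $[n]$, and every subset of $[n]$ of size $r$ is an edge independently with probability $p_r$. $H'=(V',E')$ is a strong subgraph of $H=(V,E)$ if $V'\subseteq V$ and $E'\subseteq E$. $H'=(V',E')$ is a weak subgraph of $H=(V,E)$ if $V'\subseteq V$ and $E'\subseteq\{e\cap V': e\in E\}$ (empty sets discarded, no repeated edges). "Contains $H$ as a weak subgraph" means it has a weak subgraph isomorphic to $H$. Asymptotics are as $n\to\infty$; a.a.s. means with probability tending to $1$.
   Formalization: In (b) every edge of H is assumed to have size between 1 and M (otherwise (b) fails, e.g. H a single edge of size M+1 and all p_r=1), and the condition on H' is required only for strong subgraphs with at least one vertex, since the null hypergraph has μ_w=1. *)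

theory Defs
  imports "HOL-Probability.Probability"
begin

type_synonym 'a hypergraph = "'a set \<times> 'a set set"

abbreviation verts :: "'a hypergraph \<Rightarrow> 'a set" where "verts H \<equiv> fst H"
abbreviation edges :: "'a hypergraph \<Rightarrow> 'a set set" where "edges H \<equiv> snd H"

definition hypergraph :: "'a hypergraph \<Rightarrow> bool" where
  "hypergraph H \<longleftrightarrow> finite (verts H) \<and> edges H \<subseteq> Pow (verts H)"

definition num_verts :: "'a hypergraph \<Rightarrow> nat" where
  "num_verts H = card (verts H)"

definition num_edges :: "nat \<Rightarrow> 'a hypergraph \<Rightarrow> nat" where
  "num_edges r H = card {e \<in> edges H. card e = r}"

definition strong_subgraph :: "'a hypergraph \<Rightarrow> 'a hypergraph \<Rightarrow> bool" where
  "strong_subgraph H' H \<longleftrightarrow>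
     hypergraph H' \<and> verts H' \<subseteq> verts H \<and> edges H' \<subseteq> edges H"

definition weak_subgraph :: "'a hypergraph \<Rightarrow> 'a hypergraph \<Rightarrow> bool" where
  "weak_subgraph H' H \<longleftrightarrow>
     hypergraph H' \<and> verts H' \<subseteq> verts H \<and>
     edges H' \<subseteq> {e \<inter> verts H' | e. e \<in> edges H} - {{}}"

definition hypergraph_iso :: "'a hypergraph \<Rightarrow> 'b hypergraph \<Rightarrow> bool" where
  "hypergraph_iso H K \<longleftrightarrow>
     (\<exists>\<phi>. bij_betw \<phi> (verts H) (verts K) \<and> edges K = (\<lambda>e. \<phi> ` e) ` edges H)"

definition contains_weakly :: "'b hypergraph \<Rightarrow> 'a hypergraph \<Rightarrow> bool" where
  "contains_weakly G H \<longleftrightarrow> (\<exists>K. weak_subgraph K G \<and> hypergraph_iso H K)"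

text \<open>The probabilities \<open>p\<^sub>r\<close> are indexed by \<open>r \<ge> 1\<close>, so the empty set is never an edge
  and the value of \<open>q\<close> at \<open>0\<close> is irrelevant.\<close>

definition random_hypergraph :: "nat \<Rightarrow> (nat \<Rightarrow> real) \<Rightarrow> nat hypergraph pmf" where
  "random_hypergraph n q =
     map_pmf (\<lambda>\<omega>. ({1..n}, {e. \<omega> e}))
       (Pi_pmf (Pow {1..n} - {{}}) False (\<lambda>e. bernoulli_pmf (q (card e))))"

text \<open>In the following, \<open>p r n\<close> stands for \<open>p\<^sub>r(n)\<close>.\<close>

definition bounded_seq :: "nat \<Rightarrow> (nat \<Rightarrow> nat \<Rightarrow> real) \<Rightarrow> bool" where
  "bounded_seq M p \<longleftrightarrow>
     (\<forall>n. (\<forall>r\<in>{1..M}. 0 \<le> p r n \<and> p r n \<le> 1) \<and> (\<forall>r>M. p r n = 0))"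

definition p_prime :: "nat \<Rightarrow> (nat \<Rightarrow> nat \<Rightarrow> real) \<Rightarrow> nat \<Rightarrow> nat \<Rightarrow> real" where
  "p_prime M p r n = (\<Sum>k=0..M - r. real n ^ k * p (r + k) n)"

definition mu_w :: "nat \<Rightarrow> (nat \<Rightarrow> nat \<Rightarrow> real) \<Rightarrow> 'a hypergraph \<Rightarrow> nat \<Rightarrow> real" where
  "mu_w M p H n =
     real n ^ num_verts H * (\<Prod>r=1..M. p_prime M p r n ^ num_edges r H)"

definition aas :: "(nat \<Rightarrow> 'b pmf) \<Rightarrow> ('b \<Rightarrow> bool) \<Rightarrow> bool" where
  "aas X P \<longleftrightarrow> (\<lambda>n. measure_pmf.prob (X n) {x. P x}) \<longlonglongrightarrow> 1"

end

theory Submission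
  imports Defs
begin

text \<open>For a fixed vertex set \<open>W\<close>, distinct subsets of \<open>W\<close> are traces of disjoint families of
  potential edges, so the traces on \<open>W\<close> occur independently. A set of size \<open>r\<close> is a trace with
  probability at most \<open>p'\<^sub>r\<close>, and at least a constant times \<open>min 1 p'\<^sub>r\<close> if linearly many vertices
  lie outside \<open>W\<close>. With \<open>W\<close> the image of \<open>H'\<close>, the upper bound and a union bound over all
  placements give (a). For (b), fix a window \<open>W\<close> of linear size with linear complement and find
  \<open>H\<close> as an ordinary subgraph of the hypergraph of traces on \<open>W\<close> by the second moment method.\<close>

section \<open>Disjoint families of independent potential edges\<close>

text \<open>Inclusion-exclusion, one family at a time: hitting \<open>F i\<close> is the complement
  of missing it, and missing it means enlarging the set \<open>Z\<close> of forced non-edges by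
  \<open>F i\<close>. The set \<open>Z\<close> is carried along so that the induction hypothesis
  also covers the subtracted event.\<close>

lemma prob_Pi_pmf_none_and_hits:
  assumes "finite A" "finite I" "\<And>i. i \<in> I \<Longrightarrow> F i \<subseteq> A" "disjoint_family_on F I"
    and "Z \<subseteq> A" "\<And>i. i \<in> I \<Longrightarrow> Z \<inter> F i = {}" "\<And>e. e \<in> A \<Longrightarrow> 0 \<le> q e \<and> q e \<le> 1"
  shows "measure_pmf.prob (Pi_pmf A False (\<lambda>e. bernoulli_pmf (q e)))
           {\<omega>. (\<forall>f\<in>Z. \<not> \<omega> f) \<and> (\<forall>i\<in>I. \<exists>f\<in>F i. \<omega> f)}
         = (\<Prod>f\<in>Z. 1 - q f) * (\<Prod>i\<in>I. 1 - (\<Prod>f\<in>F i. 1 - q f))"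
  using assms(2-6)
proof (induction I arbitrary: Z rule: finite_induct)
  case empty
  let ?P = "Pi_pmf A False (\<lambda>e. bernoulli_pmf (q e))"
  let ?B = "\<lambda>e. if e \<in> Z then {False} else UNIV"
  have eq: "{\<omega>. \<forall>f\<in>Z. \<not> \<omega> f} = Pi A ?B"
    using empty by (auto simp: Pi_def split: if_splits)
  have "measure_pmf.prob ?P (Pi A ?B) = (\<Prod>e\<in>A. measure_pmf.prob (bernoulli_pmf (q e)) (?B e))"
    by (rule measure_Pi_pmf_Pi[OF assms(1)])
  also have "\<dots> = (\<Prod>e\<in>A. if e \<in> Z then 1 - q e else 1)"
    using assms(7) by (intro prod.cong) (auto simp: measure_pmf_single)
  also have "\<dots> = (\<Prod>e\<in>A \<inter> Z. 1 - q e)"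
    using assms(1) by (simp add: prod.inter_restrict)
  also have "A \<inter> Z = Z" using empty by auto
  finally show ?case by (simp add: eq)
next
  case (insert i I)
  let ?P = "Pi_pmf A False (\<lambda>e. bernoulli_pmf (q e))"
  let ?E = "\<lambda>Z. {\<omega>. (\<forall>f\<in>Z. \<not> \<omega> f) \<and> (\<forall>i\<in>I. \<exists>f\<in>F i. \<omega> f)}"
  have dis: "Z \<inter> F i = {}" "\<And>j. j \<in> I \<Longrightarrow> F i \<inter> F j = {}" "\<And>j. j \<in> I \<Longrightarrow> Z \<inter> F j = {}"
    using insert.prems insert.hyps by (auto simp: disjoint_family_on_def)
  have fin: "finite Z" "finite (F i)"
    using insert.prems assms(1) by (auto intro: finite_subset)
  have IH: "measure_pmf.prob ?P (?E Y) = (\<Prod>f\<in>Y. 1 - q f) * (\<Prod>i\<in>I. 1 - (\<Prod>f\<in>F i. 1 - q f))"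
    if "Y = Z \<or> Y = Z \<union> F i" for Y
  proof (rule insert.IH)
    show "Y \<inter> F j = {}" if "j \<in> I" for j
      using dis that \<open>Y = Z \<or> Y = Z \<union> F i\<close> by blast
  qed (use insert.prems that in \<open>auto simp: disjoint_family_on_def\<close>)
  have "{\<omega>. (\<forall>f\<in>Z. \<not> \<omega> f) \<and> (\<forall>i\<in>insert i I. \<exists>f\<in>F i. \<omega> f)} = ?E Z - ?E (Z \<union> F i)"
    by auto
  moreover have "measure_pmf.prob ?P (?E Z - ?E (Z \<union> F i))
      = measure_pmf.prob ?P (?E Z) - measure_pmf.prob ?P (?E (Z \<union> F i))"
    by (rule measure_pmf.finite_measure_Diff) auto
  ultimately show ?case
    using insert.hyps fin dis(1) by (simp add: IH prod.union_disjoint algebra_simps)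
qed

section \<open>Products over subsets and elementary inequalities\<close>

lemma prod_Pow_card:
  assumes "finite B"
  shows "(\<Prod>T\<in>Pow B. f (card T)) = (\<Prod>k\<le>card B. f k ^ (card B choose k))"
proof -
  have "(\<Prod>T\<in>Pow B. f (card T)) = (\<Prod>k\<le>card B. \<Prod>T\<in>{T\<in>Pow B. card T = k}. f (card T))"
    using assms by (intro prod.group[symmetric]) (auto intro: card_mono)
  also have "\<dots> = (\<Prod>k\<le>card B. f k ^ (card B choose k))"
    using assms by (intro prod.cong) (auto simp: n_subsets Pow_def)
  finally show ?thesis .
qed

lemma sum_Pow_card:
  fixes f :: "nat \<Rightarrow> real"
  assumes "finite B"
  shows "(\<Sum>T\<in>Pow B. f (card T)) = (\<Sum>k\<le>card B. real (card B choose k) * f k)"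
proof -
  have "(\<Sum>T\<in>Pow B. f (card T)) = (\<Sum>k\<le>card B. \<Sum>T\<in>{T\<in>Pow B. card T = k}. f (card T))"
    using assms by (intro sum.group[symmetric]) (auto intro: card_mono)
  also have "\<dots> = (\<Sum>k\<le>card B. real (card B choose k) * f k)"
    using assms by (intro sum.cong) (auto simp: n_subsets Pow_def)
  finally show ?thesis .
qed

text \<open>The union bound for independent events, in product form.\<close>

lemma one_minus_prod_le_sum:
  fixes x :: "'i \<Rightarrow> real"
  assumes "finite I" "\<And>i. i \<in> I \<Longrightarrow> 0 \<le> x i \<and> x i \<le> 1"
  shows "1 - (\<Prod>i\<in>I. 1 - x i) \<le> (\<Sum>i\<in>I. x i)"
  using assms
proof (induction I rule: finite_induct)
  case (insert i I)
  have "(\<Prod>i\<in>I. 1 - x i) \<le> 1"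
    using insert.prems by (intro prod_le_1) auto
  hence "x i * (\<Prod>i\<in>I. 1 - x i) \<le> x i * 1"
    using insert.prems by (intro mult_left_mono) auto
  thus ?case using insert by (simp add: algebra_simps)
qed auto

text \<open>Since 1 - x \<le> exp (-x), the product is at most 1 / (1 + s), where s is the sum. The
  right-hand side never exceeds 1, so a lower bound linear in s is possible only with a cap.\<close>

lemma one_minus_prod_ge_min:
  fixes x :: "'i \<Rightarrow> real"
  assumes "finite I" "\<And>i. i \<in> I \<Longrightarrow> 0 \<le> x i \<and> x i \<le> 1"
  shows "min 1 (\<Sum>i\<in>I. x i) / 2 \<le> 1 - (\<Prod>i\<in>I. 1 - x i)"
proof -
  define s where "s = (\<Sum>i\<in>I. x i)"
  have s: "0 \<le> s" unfolding s_def using assms by (intro sum_nonneg) auto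
  have "(\<Prod>i\<in>I. 1 - x i) \<le> (\<Prod>i\<in>I. exp (- x i))"
  proof (rule prod_mono)
    fix i assume "i \<in> I"
    thus "0 \<le> 1 - x i \<and> 1 - x i \<le> exp (- x i)"
      using assms(2)[of i] exp_ge_add_one_self[of "- x i"] by simp
  qed
  also have "\<dots> = exp (- s)" using assms(1) by (simp add: s_def sum_negf flip: exp_sum)
  also have "\<dots> = 1 / exp s" by (simp add: exp_minus field_simps)
  also have "\<dots> \<le> 1 / (1 + s)" using s by (intro divide_left_mono) auto
  \<comment> \<open>For s \<le> 1 this reduces to s * s \<le> s, for larger s to 1 / (1 + s) \<le> 1
    / 2.\<close>
  also have "\<dots> \<le> 1 - min 1 s / 2"
    using s mult_left_le_one_le[of s s] by (cases "s \<le> 1") (auto simp: field_simps)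
  finally show ?thesis by (simp add: s_def)
qed

section \<open>Traces on a window and their probabilities\<close>

definition trace_edge :: "'v set \<Rightarrow> 'v set \<Rightarrow> ('v set \<Rightarrow> bool) \<Rightarrow> 'v set \<Rightarrow> bool" where
  "trace_edge U W \<omega> S \<longleftrightarrow> (\<exists>f. f \<subseteq> U \<and> f \<inter> W = S \<and> \<omega> f)"

text \<open>A set of size \<open>r\<close> is the trace of \<open>b choose k\<close> sets of size \<open>r + k\<close>, where \<open>b\<close> is the
  number of vertices outside the window.\<close>

definition trace_prob :: "(nat \<Rightarrow> real) \<Rightarrow> nat \<Rightarrow> nat \<Rightarrow> real" where
  "trace_prob q b r = 1 - (\<Prod>k\<le>b. (1 - q (r + k)) ^ (b choose k))"

text \<open>Every potential edge has exactly one trace on \<open>W\<close>, so different traces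
  depend on disjoint families of potential edges. Excluding the empty trace keeps the empty set,
  which is never an edge, out of these families.\<close>

lemma prob_trace_edges:
  fixes U W :: "'v set"
  assumes U: "finite U" "W \<subseteq> U" and SS: "SS \<subseteq> Pow W - {{}}"
    and q: "\<And>r. r \<ge> 1 \<Longrightarrow> 0 \<le> q r \<and> q r \<le> 1"
  shows "measure_pmf.prob (Pi_pmf (Pow U - {{}}) False (\<lambda>e. bernoulli_pmf (q (card e))))
           {\<omega>. \<forall>S\<in>SS. trace_edge U W \<omega> S} = (\<Prod>S\<in>SS. trace_prob q (card (U - W)) (card S))"
proof -
  define F where "F S = {f. f \<subseteq> U \<and> f \<inter> W = S}" for S
  have fW: "finite W" using U finite_subset by blast
  have fSS: "finite SS" using fW SS by (meson finite_Diff finite_Pow_iff finite_subset)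
  have "measure_pmf.prob (Pi_pmf (Pow U - {{}}) False (\<lambda>e. bernoulli_pmf (q (card e))))
          {\<omega>. (\<forall>f\<in>{}. \<not> \<omega> f) \<and> (\<forall>S\<in>SS. \<exists>f\<in>F S. \<omega> f)}
      = (\<Prod>f\<in>({} :: 'v set set). 1 - q (card f)) * (\<Prod>S\<in>SS. 1 - (\<Prod>f\<in>F S. 1 - q (card f)))"
  proof (rule prob_Pi_pmf_none_and_hits[where q = "\<lambda>e. q (card e)"])
    fix e assume "e \<in> Pow U - {{}}"
    hence "card e \<ge> 1" using U(1) by (metis Diff_iff One_nat_def Pow_iff Suc_leI card_gt_0_iff finite_subset singletonI)
    thus "0 \<le> q (card e) \<and> q (card e) \<le> 1" using q by blast
  qed (use U fSS SS in \<open>auto simp: F_def disjoint_family_on_def\<close>)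
  also have "{\<omega>. (\<forall>f\<in>{}. \<not> \<omega> f) \<and> (\<forall>S\<in>SS. \<exists>f\<in>F S. \<omega> f)} = {\<omega>. \<forall>S\<in>SS. trace_edge U W \<omega> S}"
    by (auto simp: F_def trace_edge_def)
  also have "(\<Prod>f\<in>F S. 1 - q (card f)) = (\<Prod>k\<le>card (U - W). (1 - q (card S + k)) ^ (card (U - W) choose k))"
    if "S \<in> SS" for S
  proof -
    have S: "S \<subseteq> W" "finite S" using SS that fW by (auto intro: finite_subset)
    \<comment> \<open>A set with trace \<open>S\<close> is determined by its part outside
      \<open>W\<close>, which may be any subset of \<open>U - W\<close>.\<close>
    have "(\<Prod>f\<in>F S. 1 - q (card f)) = (\<Prod>T\<in>Pow (U - W). 1 - q (card S + card T))"
    proof (rule prod.reindex_bij_witness[where i = "\<lambda>T. S \<union> T" and j = "\<lambda>f. f - W"])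
      fix f assume f: "f \<in> F S"
      hence "f = S \<union> (f - W)" "S \<inter> (f - W) = {}" "finite (f - W)"
        using U finite_subset by (auto simp: F_def)
      thus "1 - q (card S + card (f - W)) = 1 - q (card f)"
        using S(2) card_Un_disjoint by metis
    qed (use S U in \<open>auto simp: F_def\<close>)
    also have "\<dots> = (\<Prod>k\<le>card (U - W). (1 - q (card S + k)) ^ (card (U - W) choose k))"
      using U by (intro prod_Pow_card) auto
    finally show ?thesis .
  qed
  hence "(\<Prod>S\<in>SS. 1 - (\<Prod>f\<in>F S. 1 - q (card f))) = (\<Prod>S\<in>SS. trace_prob q (card (U - W)) (card S))"
    unfolding trace_prob_def by (intro prod.cong) auto
  finally show ?thesis by simp
qed

lemma trace_prob_bounds:
  assumes q: "\<And>r. r \<ge> 1 \<Longrightarrow> 0 \<le> q r \<and> q r \<le> 1" and r: "r \<ge> 1"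
  shows "0 \<le> trace_prob q b r" "trace_prob q b r \<le> 1"
    and "trace_prob q b r \<le> (\<Sum>k\<le>b. real (b choose k) * q (r + k))"
    and "min 1 (\<Sum>k\<le>b. real (b choose k) * q (r + k)) / 2 \<le> trace_prob q b r"
proof -
  have q': "0 \<le> q (r + k) \<and> q (r + k) \<le> 1" for k using q r by simp
  \<comment> \<open>The binomial coefficients are unfolded into subsets of a set with
    \<open>b\<close> elements, which brings the bounds into the form of the general inequalities for
    products of factors 1 - x.\<close>
  have eq: "trace_prob q b r = 1 - (\<Prod>T\<in>Pow {..<b}. 1 - q (r + card T))"
    using prod_Pow_card[of "{..<b}" "\<lambda>k. 1 - q (r + k)"] by (simp add: trace_prob_def)
  have eq2: "(\<Sum>k\<le>b. real (b choose k) * q (r + k)) = (\<Sum>T\<in>Pow {..<b}. q (r + card T))"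
    using sum_Pow_card[of "{..<b}" "\<lambda>k. q (r + k)"] by simp
  show "0 \<le> trace_prob q b r"
    using prod_le_1[of "Pow {..<b}" "\<lambda>T. 1 - q (r + card T)"] q' by (simp add: eq)
  show "trace_prob q b r \<le> 1"
    using prod_nonneg[of "Pow {..<b}" "\<lambda>T. 1 - q (r + card T)"] q' by (simp add: eq)
  show "trace_prob q b r \<le> (\<Sum>k\<le>b. real (b choose k) * q (r + k))"
    unfolding eq eq2 using q' by (intro one_minus_prod_le_sum) auto
  show "min 1 (\<Sum>k\<le>b. real (b choose k) * q (r + k)) / 2 \<le> trace_prob q b r"
    unfolding eq eq2 using q' by (intro one_minus_prod_ge_min) auto
qed

section \<open>Comparison of trace probabilities with \<open>p_prime\<close>\<close>

lemma bounded_seq_prob: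
  assumes "bounded_seq M p" "r \<ge> 1"
  shows "0 \<le> p r n \<and> p r n \<le> 1"
  using assms by (cases "r \<le> M") (auto simp: bounded_seq_def)

lemma p_prime_nonneg: "bounded_seq M p \<Longrightarrow> r \<ge> 1 \<Longrightarrow> 0 \<le> p_prime M p r n"
  unfolding p_prime_def using bounded_seq_prob[of M p] by (intro sum_nonneg mult_nonneg_nonneg) auto

lemma trace_prob_le_p_prime:
  assumes p: "bounded_seq M p" and r: "r \<in> {1..M}" and b: "b \<le> n"
  shows "trace_prob (\<lambda>r. p r n) b r \<le> p_prime M p r n"
proof -
  have p01: "0 \<le> p r n \<and> p r n \<le> 1" if "r \<ge> 1" for r using bounded_seq_prob[OF p that] .
  have "trace_prob (\<lambda>r. p r n) b r \<le> (\<Sum>k\<le>b. real (b choose k) * p (r + k) n)"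
    using p01 r by (intro trace_prob_bounds) auto
  \<comment> \<open>Either of \<open>b\<close> and \<open>M - r\<close> may be the larger one, so
    the comparison passes through the union of both ranges. Terms with k > M - r vanish.\<close>
  also have "\<dots> \<le> (\<Sum>k\<in>{..b} \<union> {0..M - r}. real n ^ k * p (r + k) n)"
  proof (rule sum_mono2[THEN order_trans[rotated]])
    show "(\<Sum>k\<le>b. real (b choose k) * p (r + k) n) \<le> (\<Sum>k\<le>b. real n ^ k * p (r + k) n)"
    proof (rule sum_mono)
      fix k assume k: "k \<in> {..b}"
      have "b choose k \<le> n ^ k"
        using k b binomial_le_pow[of k b] power_mono[of b n k] by simp
      hence "real (b choose k) \<le> real n ^ k" by (metis of_nat_le_iff of_nat_power)
      thus "real (b choose k) * p (r + k) n \<le> real n ^ k * p (r + k) n"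
        using p01[of "r + k"] r by (intro mult_right_mono) auto
    qed
  qed (use p01 r in auto)
  also have "\<dots> = p_prime M p r n"
    unfolding p_prime_def using p r
    by (intro sum.mono_neutral_right) (auto simp: bounded_seq_def)
  finally show ?thesis .
qed

text \<open>For 0 < k \<le> M - r, \<open>b choose k\<close> is at least (b / k)^k, hence at least
  (n / (C M))^k. As C M \<ge> 1, the constant (1 / (C M))^M serves all k at once. The further factor
  1 / 2 and the cap come from \<open>one_minus_prod_ge_min\<close>.\<close>

lemma trace_prob_ge_p_prime:
  assumes p: "bounded_seq M p" and r: "r \<in> {1..M}" and b: "M \<le> b" "real n \<le> C * real b" and C: "1 \<le> C"
  shows "(1 / (C * M)) ^ M / 2 * min 1 (p_prime M p r n) \<le> trace_prob (\<lambda>r. p r n) b r"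
proof -
  have p01: "0 \<le> p r n \<and> p r n \<le> 1" if "r \<ge> 1" for r using bounded_seq_prob[OF p that] .
  define c where "c = (1 / (C * M)) ^ M"
  have CM: "1 \<le> C * M" using C r mult_mono[of 1 C 1 "real M"] by simp
  have c: "0 \<le> c" "c \<le> 1" using CM by (auto simp: c_def intro!: power_le_one)
  have "c * p_prime M p r n = (\<Sum>k=0..M - r. (c * real n ^ k) * p (r + k) n)"
    by (simp add: p_prime_def sum_distrib_left mult.assoc)
  also have "\<dots> \<le> (\<Sum>k=0..M - r. real (b choose k) * p (r + k) n)"
  proof (rule sum_mono)
    fix k assume k: "k \<in> {0..M - r}"
    have "c * real n ^ k \<le> (1 / (C * M)) ^ k * real n ^ k"
      unfolding c_def using CM k by (intro mult_right_mono power_decreasing) auto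
    also have "\<dots> = (real n / (C * M)) ^ k" by (simp add: power_divide)
    also have "\<dots> \<le> (real b / real k) ^ k"
    \<comment> \<open>For \<open>k = 0\<close> the quotient by \<open>k\<close> is 0 by convention,
      but both zeroth powers are 1.\<close>
    proof (cases "k = 0")
      case False
      have "real n / (C * M) \<le> real b / real M"
        using b(2) C r by (simp add: field_simps)
      also have "\<dots> \<le> real b / real k"
        using False k r by (intro divide_left_mono) auto
      finally show ?thesis using C by (intro power_mono) auto
    qed auto
    also have "\<dots> \<le> real (b choose k)"
      using k b by (intro binomial_ge_n_over_k_pow_k) auto
    finally show "(c * real n ^ k) * p (r + k) n \<le> real (b choose k) * p (r + k) n"
      using p01[of "r + k"] r by (intro mult_right_mono) auto
  qed
  also have "\<dots> \<le> (\<Sum>k\<le>b. real (b choose k) * p (r + k) n)"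
    using b p01 r by (intro sum_mono2) auto
  finally have "min 1 (c * p_prime M p r n) \<le> min 1 (\<Sum>k\<le>b. real (b choose k) * p (r + k) n)"
    by simp
  moreover have "c * min 1 (p_prime M p r n) \<le> min 1 (c * p_prime M p r n)"
    using c mult_left_mono[of "min 1 (p_prime M p r n)" 1 c] mult_left_mono[of "min 1 (p_prime M p r n)" "p_prime M p r n" c] by auto
  moreover have "min 1 (\<Sum>k\<le>b. real (b choose k) * p (r + k) n) / 2 \<le> trace_prob (\<lambda>r. p r n) b r"
    using p01 r by (intro trace_prob_bounds(4)) auto
  ultimately show ?thesis
    unfolding c_def[symmetric] by linarith
qed

section \<open>First moment bound for weak copies\<close>

lemma mu_w_eq_prod_edges:
  assumes "hypergraph H"
  shows "mu_w M p H n
    = real n ^ card (verts H) * (\<Prod>e\<in>{e\<in>edges H. card e \<in> {1..M}}. p_prime M p (card e) n)"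
proof -
  have fin: "finite (edges H)"
    using assms by (auto simp: hypergraph_def intro: finite_subset)
  have "(\<Prod>r=1..M. p_prime M p r n ^ num_edges r H)
      = (\<Prod>r=1..M. \<Prod>e\<in>{e\<in>{e\<in>edges H. card e \<in> {1..M}}. card e = r}. p_prime M p (card e) n)"
  proof (intro prod.cong refl)
    fix r assume "r \<in> {1..M}"
    hence "{e\<in>{e\<in>edges H. card e \<in> {1..M}}. card e = r} = {e\<in>edges H. card e = r}" by auto
    thus "p_prime M p r n ^ num_edges r H
        = (\<Prod>e\<in>{e\<in>{e\<in>edges H. card e \<in> {1..M}}. card e = r}. p_prime M p (card e) n)"
      by (simp add: num_edges_def)
  qed
  also have "\<dots> = (\<Prod>e\<in>{e\<in>edges H. card e \<in> {1..M}}. p_prime M p (card e) n)"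
    using fin by (intro prod.group) auto
  finally show ?thesis by (simp add: mu_w_def num_verts_def)
qed

lemma inj_on_image_family: "inj_on \<phi> V \<Longrightarrow> SS \<subseteq> Pow V \<Longrightarrow> inj_on (image \<phi>) SS"
  by (meson inj_on_image_Pow inj_on_subset)

text \<open>An edge of a weak copy of \<open>H\<close> is a trace on the vertex set of that copy. If
  it comes from an edge of \<open>H'\<close>, it lies inside the image of \<open>verts H'\<close>,
  and cutting down to that image leaves it unchanged. The isomorphism is restricted to
  \<open>verts H'\<close> so that a finite \<open>U\<close> leaves only finitely many
  candidates.\<close>

lemma contains_weakly_imp_traces:
  assumes "contains_weakly (U, {f. \<omega> f}) H" "strong_subgraph H' H" "\<And>f. \<omega> f \<Longrightarrow> f \<subseteq> U"
  obtains \<phi> where "\<phi> \<in> verts H' \<rightarrow>\<^sub>E U" "inj_on \<phi> (verts H')"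
    and "\<And>e. e \<in> edges H' \<Longrightarrow> trace_edge U (\<phi> ` verts H') \<omega> (\<phi> ` e)"
proof -
  obtain K \<psi> where K: "weak_subgraph K (U, {f. \<omega> f})"
    and \<psi>: "bij_betw \<psi> (verts H) (verts K)" "edges K = (\<lambda>e. \<psi> ` e) ` edges H"
    using assms(1) unfolding contains_weakly_def hypergraph_iso_def by auto
  have H': "verts H' \<subseteq> verts H" "edges H' \<subseteq> edges H" "edges H' \<subseteq> Pow (verts H')"
    using assms(2) by (auto simp: strong_subgraph_def hypergraph_def)
  define \<phi> where "\<phi> = restrict \<psi> (verts H')"
  have img: "\<phi> ` S = \<psi> ` S" if "S \<subseteq> verts H'" for S
    using that by (auto simp: \<phi>_def)
  have sub: "\<psi> ` verts H' \<subseteq> verts K" "verts K \<subseteq> U"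
    using \<psi>(1) H'(1) K by (auto simp: bij_betw_def weak_subgraph_def)
  show ?thesis
  proof (rule that)
    show "\<phi> \<in> verts H' \<rightarrow>\<^sub>E U" using sub by (auto simp: \<phi>_def)
    show "inj_on \<phi> (verts H')"
      using \<psi>(1) H'(1) by (auto simp: \<phi>_def bij_betw_def inj_on_def)
    fix e assume e: "e \<in> edges H'"
    hence "\<psi> ` e \<in> edges K" using H' \<psi>(2) by auto
    moreover have "edges K \<subseteq> {f \<inter> verts K | f. \<omega> f}"
      using K by (auto simp: weak_subgraph_def)
    ultimately obtain f where f: "\<omega> f" "\<psi> ` e = f \<inter> verts K"
      by blast
    have e': "e \<subseteq> verts H'" using e H'(3) by auto
    have "f \<inter> \<psi> ` verts H' = \<psi> ` e" using f(2) sub(1) e' by blast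
    thus "trace_edge U (\<phi> ` verts H') \<omega> (\<phi> ` e)"
      using f(1) assms(3)[OF f(1)] img[OF e'] img[OF order_refl] unfolding trace_edge_def by metis
  qed
qed

text \<open>There are at most n^v(H') injections of \<open>verts H'\<close> into the vertices. With
  the image as window, each of them produces all required traces with probability at most the
  product of the \<open>p_prime\<close> factors.\<close>

lemma prob_contains_weakly_le_mu_w:
  assumes p: "bounded_seq M p" and H': "strong_subgraph H' H"
  shows "measure_pmf.prob (random_hypergraph n (\<lambda>r. p r n)) {G. contains_weakly G H} \<le> mu_w M p H' n"
proof -
  let ?U = "{1..n}" and ?V = "verts H'"
  define P where "P = Pi_pmf (Pow ?U - {{}}) False (\<lambda>e. bernoulli_pmf (p (card e) n))"
  \<comment> \<open>Edges of other sizes do not enter \<open>mu_w\<close>; ignoring them only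
    enlarges the events \<open>T \<phi>\<close>.\<close>
  define E where "E = {e\<in>edges H'. card e \<in> {1..M}}"
  define I where "I = {\<phi>\<in>?V \<rightarrow>\<^sub>E ?U. inj_on \<phi> ?V}"
  define T where "T \<phi> = {\<omega>. \<forall>S\<in>image \<phi> ` E. trace_edge ?U (\<phi> ` ?V) \<omega> S}" for \<phi>
  have fV: "finite ?V" and E: "E \<subseteq> Pow ?V" and hyp: "hypergraph H'"
    using H' by (auto simp: strong_subgraph_def hypergraph_def E_def)
  have p01: "0 \<le> p r n \<and> p r n \<le> 1" if "r \<ge> 1" for r using bounded_seq_prob[OF p that] .
  have finPiE: "finite (?V \<rightarrow>\<^sub>E ?U)" using fV by (intro finite_PiE) auto
  hence finI: "finite I" by (simp add: I_def)
  have "card I \<le> card (?V \<rightarrow>\<^sub>E ?U)" using finPiE by (intro card_mono) (auto simp: I_def)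
  also have "\<dots> = n ^ card ?V" using fV by (simp add: card_PiE)
  finally have cardI: "real (card I) \<le> real n ^ card ?V" by (metis of_nat_le_iff of_nat_power)
  have prob_T: "measure_pmf.prob P (T \<phi>) \<le> (\<Prod>e\<in>E. p_prime M p (card e) n)" if "\<phi> \<in> I" for \<phi>
  proof -
    have \<phi>: "\<phi> ` ?V \<subseteq> ?U" "inj_on \<phi> ?V" using that by (auto simp: I_def)
    have "{} \<notin> E" by (auto simp: E_def)
    hence SS: "image \<phi> ` E \<subseteq> Pow (\<phi> ` ?V) - {{}}" using E by blast
    have "measure_pmf.prob P (T \<phi>)
        = (\<Prod>S\<in>image \<phi> ` E. trace_prob (\<lambda>r. p r n) (card (?U - \<phi> ` ?V)) (card S))"
      unfolding P_def T_def using \<phi> SS p01 by (intro prob_trace_edges) auto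
    also have "\<dots> = (\<Prod>e\<in>E. trace_prob (\<lambda>r. p r n) (card (?U - \<phi> ` ?V)) (card (\<phi> ` e)))"
      using inj_on_image_family[OF \<phi>(2) E] by (simp add: prod.reindex)
    also have "\<dots> = (\<Prod>e\<in>E. trace_prob (\<lambda>r. p r n) (card (?U - \<phi> ` ?V)) (card e))"
      using \<phi>(2) E by (intro prod.cong refl arg_cong2[where f = "trace_prob _"] card_image)
        (auto intro: inj_on_subset)
    also have "\<dots> \<le> (\<Prod>e\<in>E. p_prime M p (card e) n)"
    proof (rule prod_mono)
      fix e assume "e \<in> E"
      hence e: "card e \<in> {1..M}" by (auto simp: E_def)
      have "card (?U - \<phi> ` ?V) \<le> n" using card_mono[of ?U "?U - \<phi> ` ?V"] by simp
      thus "0 \<le> trace_prob (\<lambda>r. p r n) (card (?U - \<phi> ` ?V)) (card e) \<and>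
          trace_prob (\<lambda>r. p r n) (card (?U - \<phi> ` ?V)) (card e) \<le> p_prime M p (card e) n"
        using trace_prob_le_p_prime[OF p e] trace_prob_bounds(1)[of "\<lambda>r. p r n" "card e"] p01 e
        by auto
    qed
    finally show ?thesis .
  qed
  have "measure_pmf.prob (random_hypergraph n (\<lambda>r. p r n)) {G. contains_weakly G H}
      = measure_pmf.prob P {\<omega>. contains_weakly (?U, {e. \<omega> e}) H}"
    by (simp add: random_hypergraph_def P_def vimage_def)
  also have "\<dots> \<le> measure_pmf.prob P (\<Union>\<phi>\<in>I. T \<phi>)"
  \<comment> \<open>The inclusion is needed only on the support of \<open>P\<close>, where the
    default value \<open>False\<close> rules out edges that are not subsets of the vertex
    set.\<close>
  proof (rule measure_pmf.finite_measure_mono_AE, rule AE_pmfI, rule impI)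
    fix \<omega> assume \<omega>: "\<omega> \<in> set_pmf P" "\<omega> \<in> {\<omega>. contains_weakly (?U, {e. \<omega> e}) H}"
    have "f \<subseteq> ?U" if "\<omega> f" for f
      using \<omega>(1) that set_Pi_pmf_subset[of "Pow ?U - {{}}" False] unfolding P_def by blast
    then obtain \<phi> where "\<phi> \<in> ?V \<rightarrow>\<^sub>E ?U" "inj_on \<phi> ?V"
      "\<And>e. e \<in> edges H' \<Longrightarrow> trace_edge ?U (\<phi> ` ?V) \<omega> (\<phi> ` e)"
      using contains_weakly_imp_traces[OF _ H'] \<omega>(2) by blast
    thus "\<omega> \<in> (\<Union>\<phi>\<in>I. T \<phi>)" by (auto simp: I_def T_def E_def)
  qed auto
  also have "\<dots> \<le> (\<Sum>\<phi>\<in>I. measure_pmf.prob P (T \<phi>))"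
    using finI by (intro measure_pmf.finite_measure_subadditive_finite) auto
  also have "\<dots> \<le> (\<Sum>\<phi>\<in>I. \<Prod>e\<in>E. p_prime M p (card e) n)"
    using prob_T by (intro sum_mono)
  also have "\<dots> \<le> real n ^ card ?V * (\<Prod>e\<in>E. p_prime M p (card e) n)"
    using cardI p_prime_nonneg[OF p]
    by (auto intro!: mult_right_mono prod_nonneg simp: E_def)
  finally show ?thesis
    using mu_w_eq_prod_edges[OF hyp] by (simp add: E_def)
qed

section \<open>Second moment method for placements in blocks\<close>

text \<open>Chebyshev's inequality for the number X of events \<open>T x\<close> that occur: X has
  mean m = |I| Q, and X = 0 forces (X - m)^2 = m^2. The form without division also allows m =
  0.\<close>

lemma prob_eq_zero_le_second_moment:
  fixes P :: "'w pmf" and T :: "'i \<Rightarrow> 'w set"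
  assumes "finite I" and "\<And>x. x \<in> I \<Longrightarrow> measure_pmf.prob P (T x) = Q"
  shows "measure_pmf.prob P {\<omega>. \<forall>x\<in>I. \<omega> \<notin> T x} * (real (card I) * Q)\<^sup>2
    \<le> (\<Sum>x\<in>I. \<Sum>y\<in>I. measure_pmf.prob P (T x \<inter> T y)) - (real (card I) * Q)\<^sup>2"
proof -
  define m where "m = real (card I) * Q"
  define X where "X \<omega> = (\<Sum>x\<in>I. indicator (T x) \<omega> :: real)" for \<omega>
  have int: "integrable P (indicator A :: _ \<Rightarrow> real)" for A
    by (intro integrable_real_indicator) (auto simp: measure_pmf.emeasure_eq_measure)
  have EX: "integrable P X" "measure_pmf.expectation P X = m"
    unfolding X_def using int assms by (auto simp: m_def)
  have X2: "(X \<omega>)\<^sup>2 = (\<Sum>x\<in>I. \<Sum>y\<in>I. indicator (T x \<inter> T y) \<omega>)" for \<omega>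
    unfolding X_def power2_eq_square sum_product by (simp add: indicator_inter_arith)
  have EX2: "integrable P (\<lambda>\<omega>. (X \<omega>)\<^sup>2)"
    "measure_pmf.expectation P (\<lambda>\<omega>. (X \<omega>)\<^sup>2) = (\<Sum>x\<in>I. \<Sum>y\<in>I. measure_pmf.prob P (T x \<inter> T y))"
    unfolding X2 using int by (auto simp: Bochner_Integration.integral_sum)
  have "measure_pmf.prob P {\<omega>. \<forall>x\<in>I. \<omega> \<notin> T x} * m\<^sup>2
      = measure_pmf.expectation P (\<lambda>\<omega>. indicator {\<omega>. \<forall>x\<in>I. \<omega> \<notin> T x} \<omega> * m\<^sup>2)"
    by simp
  \<comment> \<open>The new integrand is (X - m)^2, expanded so that linearity gives its
    expectation.\<close>
  also have "\<dots> \<le> measure_pmf.expectation P (\<lambda>\<omega>. (X \<omega>)\<^sup>2 - 2 * m * X \<omega> + m\<^sup>2)"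
  proof (intro integral_mono)
    show "integrable P (\<lambda>\<omega>. indicator {\<omega>. \<forall>x\<in>I. \<omega> \<notin> T x} \<omega> * m\<^sup>2)"
      using int by simp
    show "integrable P (\<lambda>\<omega>. (X \<omega>)\<^sup>2 - 2 * m * X \<omega> + m\<^sup>2)"
      using EX EX2 by simp
    fix \<omega>
    show "indicator {\<omega>. \<forall>x\<in>I. \<omega> \<notin> T x} \<omega> * m\<^sup>2 \<le> (X \<omega>)\<^sup>2 - 2 * m * X \<omega> + m\<^sup>2"
    proof (cases "\<forall>x\<in>I. \<omega> \<notin> T x")
      case True
      thus ?thesis by (simp add: X_def)
    next
      case False
      thus ?thesis using zero_le_power2[of "X \<omega> - m"] by (simp add: power2_diff algebra_simps)
    qed
  qed
  also have "\<dots> = (\<Sum>x\<in>I. \<Sum>y\<in>I. measure_pmf.prob P (T x \<inter> T y)) - m\<^sup>2"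
    using EX EX2 by (simp add: power2_eq_square)
  finally show ?thesis by (simp add: m_def)
qed

text \<open>The numbers from 1 on are cut into consecutive blocks of length \<open>N\<close>; vertex
  \<open>v\<close> goes to position \<open>x v\<close> of block \<open>g v\<close>. Positions start
  at 0 and vertices at 1, hence the \<open>Suc\<close>.\<close>

definition block_embed :: "('a \<Rightarrow> nat) \<Rightarrow> nat \<Rightarrow> ('a \<Rightarrow> nat) \<Rightarrow> 'a \<Rightarrow> nat" where
  "block_embed g N x v = g v * N + Suc (x v)"

text \<open>Division with remainder by \<open>N\<close> recovers block and position.\<close>

lemma block_embed_eq_iff:
  assumes "x v < N" "y w < N"
  shows "block_embed g N x v = block_embed g N y w \<longleftrightarrow> g v = g w \<and> x v = y w"
proof
  assume "block_embed g N x v = block_embed g N y w"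
  hence eq: "g v * N + x v = g w * N + y w" by (simp add: block_embed_def)
  have "(g v * N + x v) div N = g v" "(g w * N + y w) div N = g w"
    using assms by (simp_all add: div_mult_self3)
  hence "g v = g w" using eq by metis
  thus "g v = g w \<and> x v = y w" using eq by simp
qed (simp add: block_embed_def)

text \<open>Distinct vertices use disjoint blocks, so the blocks that an image meets reveal the
  original edge. Hence two placements cannot share a trace that comes from two different
  edges.\<close>

lemma block_embed_image_eq_iff:
  assumes "inj_on g V" "x \<in> V \<rightarrow> {..<N}" "y \<in> V \<rightarrow> {..<N}" "e \<subseteq> V" "e' \<subseteq> V"
  shows "block_embed g N x ` e = block_embed g N y ` e' \<longleftrightarrow> e = e' \<and> (\<forall>v\<in>e. x v = y v)"
proof
  have iff: "block_embed g N x v = block_embed g N y w \<longleftrightarrow> v = w \<and> x v = y w"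
    if "v \<in> V" "w \<in> V" for v w
    using assms(1-3) that by (subst block_embed_eq_iff) (auto simp: inj_on_def)
  assume eq: "block_embed g N x ` e = block_embed g N y ` e'"
  have 1: "v \<in> e' \<and> x v = y v" if v: "v \<in> e" for v
  proof -
    from v eq obtain w where "w \<in> e'" "block_embed g N x v = block_embed g N y w"
      by (metis imageE imageI)
    thus ?thesis using iff[of v w] v assms(4,5) by auto
  qed
  have 2: "w \<in> e" if w: "w \<in> e'" for w
  proof -
    from w eq obtain v where "v \<in> e" "block_embed g N y w = block_embed g N x v"
      by (metis imageE imageI)
    thus ?thesis using iff[of v w] w assms(4,5) by auto
  qed
  show "e = e' \<and> (\<forall>v\<in>e. x v = y v)" using 1 2 by blast
next
  assume "e = e' \<and> (\<forall>v\<in>e. x v = y v)"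
  thus "block_embed g N x ` e = block_embed g N y ` e'"
    by (auto simp: block_embed_def)
qed

lemma card_PiE_agree:
  assumes "finite V" "finite A" "U \<subseteq> V" "x \<in> V \<rightarrow>\<^sub>E A"
  shows "card {y \<in> V \<rightarrow>\<^sub>E A. \<forall>v\<in>U. x v = y v} = card A ^ (card V - card U)"
proof -
  have "{y \<in> V \<rightarrow>\<^sub>E A. \<forall>v\<in>U. x v = y v} = (\<Pi>\<^sub>E v\<in>V. if v \<in> U then {x v} else A)"
    using assms(3,4) by (fastforce simp: PiE_def Pi_def extensional_def split: if_splits)
  hence "card {y \<in> V \<rightarrow>\<^sub>E A. \<forall>v\<in>U. x v = y v} = (\<Prod>v\<in>V. card (if v \<in> U then {x v} else A))"
    using assms(1) by (simp add: card_PiE)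
  also have "\<dots> = (\<Prod>v\<in>V. if v \<in> U then 1 else card A)"
    by (intro prod.cong) auto
  also have "\<dots> = (\<Prod>v\<in>V - U. card A)"
    using assms(1,3) by (simp add: prod.If_cases Diff_eq)
  also have "\<dots> = card A ^ (card V - card U)"
    using assms(1,3) by (simp add: card_Diff_subset finite_subset)
  finally show ?thesis .
qed

text \<open>A trace on \<open>W\<close> that lies inside the image of \<open>verts H\<close> is also
  a trace on that image. The empty edge must be absent since weak subgraphs discard it.\<close>

lemma traces_imp_contains_weakly:
  assumes H: "hypergraph H" "{} \<notin> edges H" and \<phi>: "inj_on \<phi> (verts H)"
    and W: "\<phi> ` verts H \<subseteq> W" "W \<subseteq> U"
    and tr: "\<And>e. e \<in> edges H \<Longrightarrow> trace_edge U W \<omega> (\<phi> ` e)"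
  shows "contains_weakly (U, {f. \<omega> f}) H"
proof -
  define K where "K = (\<phi> ` verts H, image \<phi> ` edges H)"
  have sub: "e \<subseteq> verts H" if "e \<in> edges H" for e
    using H that by (auto simp: hypergraph_def)
  have "hypergraph K"
    using H(1) sub unfolding K_def hypergraph_def by auto
  moreover have "\<phi> ` e \<in> {f \<inter> \<phi> ` verts H | f. \<omega> f} - {{}}" if e: "e \<in> edges H" for e
  proof -
    obtain f where f: "f \<inter> W = \<phi> ` e" "\<omega> f" using tr[OF e] by (auto simp: trace_edge_def)
    have "\<phi> ` e = f \<inter> \<phi> ` verts H" using f(1) W(1) sub[OF e] by blast
    thus ?thesis using f(2) e H(2) by auto
  qed
  ultimately have "weak_subgraph K (U, {f. \<omega> f})"
    using W by (auto simp: weak_subgraph_def K_def)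
  moreover have "hypergraph_iso H K"
    unfolding hypergraph_iso_def K_def using \<phi> by (auto simp: bij_betw_def)
  ultimately show ?thesis unfolding contains_weakly_def by blast
qed

text \<open>The window consists of one block of \<open>N\<close> vertices per vertex of \<open>H\<close>. Two embeddings that
  respect the blocks share exactly the edges of \<open>H\<close> spanned by the set \<open>U\<close> of vertices on which
  they agree, hence the sum over \<open>U\<close>.\<close>

lemma prob_not_contains_weakly_le:
  fixes H :: "'a hypergraph" and q :: "nat \<Rightarrow> real"
  assumes H: "hypergraph H" "{} \<notin> edges H"
    and q: "\<And>r. r \<ge> 1 \<Longrightarrow> 0 \<le> q r \<and> q r \<le> 1"
    and N: "N > 0" "card (verts H) * N \<le> n"
    and pos: "\<And>e. e \<in> edges H \<Longrightarrow> 0 < trace_prob q (n - card (verts H) * N) (card e)"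
  shows "measure_pmf.prob (random_hypergraph n q) {G. \<not> contains_weakly G H}
    \<le> (\<Sum>U\<in>Pow (verts H) - {{}}. 1 / (real N ^ card U *
         (\<Prod>e\<in>{e\<in>edges H. e \<subseteq> U}. trace_prob q (n - card (verts H) * N) (card e))))"
proof -
  define V where "V = verts H"
  define E where "E = edges H"
  define m where "m = card V"
  define \<pi> where "\<pi> = trace_prob q (n - m * N)"
  define W where "W = {1..m * N}"
  define P where "P = Pi_pmf (Pow {1..n} - {{}}) False (\<lambda>e. bernoulli_pmf (q (card e)))"
  \<comment> \<open>A placement picks one position in each block. \<open>Q\<close> is the
    probability that a given placement yields a copy of \<open>H\<close>, and \<open>D U\<close>
    collects the factors of the edges inside \<open>U\<close>.\<close>
  define I where "I = V \<rightarrow>\<^sub>E {..<N}"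
  define D where "D U = (\<Prod>e\<in>{e\<in>E. e \<subseteq> U}. \<pi> (card e))" for U
  define Q where "Q = (\<Prod>e\<in>E. \<pi> (card e))"
  have fV: "finite V" and E: "E \<subseteq> Pow V" and fE: "finite E" and ne: "{} \<notin> E"
    using H by (auto simp: hypergraph_def V_def E_def intro: finite_subset)
  obtain g where g: "bij_betw g V {0..<m}"
    using fV ex_bij_betw_finite_nat unfolding m_def by blast
  hence ginj: "inj_on g V" and gm: "\<And>v. v \<in> V \<Longrightarrow> g v < m"
    by (auto simp: bij_betw_def)
  define \<phi> where "\<phi> = block_embed g N"
  define T where "T x = {\<omega>. \<forall>S\<in>image (\<phi> x) ` E. trace_edge {1..n} W \<omega> S}" for x
  have W: "W \<subseteq> {1..n}" "card ({1..n} - W) = n - m * N"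
    using N(2) by (auto simp: W_def m_def V_def card_Diff_subset)
  have \<pi>: "0 < \<pi> (card e)" if "e \<in> E" for e
    using pos that by (simp add: \<pi>_def E_def m_def V_def)
  have Dpos: "0 < D U" for U unfolding D_def using \<pi> by (intro prod_pos) auto
  have "{e\<in>E. e \<subseteq> {}} = {}" using ne by auto
  hence D_empty: "D {} = 1" unfolding D_def by (simp only: prod.empty)
  have Qpos: "0 < Q" unfolding Q_def using \<pi> by (intro prod_pos) auto
  have finI: "finite I" and cardI: "card I = N ^ m"
    unfolding I_def m_def using fV by (auto intro: finite_PiE simp: card_PiE)
  have I: "x \<in> V \<rightarrow> {..<N}" if "x \<in> I" for x using that by (auto simp: I_def)
  have \<phi>inj: "inj_on (\<phi> x) V" if "x \<in> I" for x
    using block_embed_eq_iff[of x _ N x _ g] ginj I[OF that]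
    unfolding inj_on_def \<phi>_def by (metis Pi_mem lessThan_iff)
  have \<phi>W: "\<phi> x ` V \<subseteq> W" if "x \<in> I" for x
  proof
    fix i assume "i \<in> \<phi> x ` V"
    then obtain v where v: "v \<in> V" "i = g v * N + Suc (x v)" by (auto simp: \<phi>_def block_embed_def)
    have "x v < N" using I[OF that] v by auto
    hence "i \<le> Suc (g v) * N" using v by simp
    also have "\<dots> \<le> m * N" using gm[OF v(1)] by (intro mult_right_mono) auto
    finally show "i \<in> W" using v by (simp add: W_def)
  qed
  have card\<phi>: "card (\<phi> x ` e) = card e" if "x \<in> I" "e \<in> E" for x e
    using \<phi>inj[OF that(1)] E that(2) by (intro card_image) (auto intro: inj_on_subset)
  have prod_copy: "(\<Prod>S\<in>image (\<phi> x) ` F. \<pi> (card S)) = (\<Prod>e\<in>F. \<pi> (card e))"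
    if "x \<in> I" "F \<subseteq> E" for x F
  proof -
    have "inj_on (image (\<phi> x)) F"
      using \<phi>inj[OF that(1)] that(2) E by (intro inj_on_image_family) auto
    thus ?thesis using card\<phi> that by (auto simp: prod.reindex intro!: prod.cong)
  qed
  have prob_tr: "measure_pmf.prob P {\<omega>. \<forall>S\<in>SS. trace_edge {1..n} W \<omega> S} = (\<Prod>S\<in>SS. \<pi> (card S))"
    if "SS \<subseteq> Pow W - {{}}" for SS
    using prob_trace_edges[OF _ W(1) that q] W(2) by (simp add: P_def \<pi>_def)
  have copy: "image (\<phi> x) ` E \<subseteq> Pow W - {{}}" if "x \<in> I" for x
    using \<phi>W[OF that] E ne by auto
  have prob_T: "measure_pmf.prob P (T x) = Q" if "x \<in> I" for x
    using prob_tr[OF copy[OF that]] prod_copy[OF that] by (simp add: T_def Q_def)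
  \<comment> \<open>The joint event asks for the union of the two sets of traces. Its probability
    times the product over the common traces is Q^2, and the common traces come from the edges on
    whose vertices \<open>x\<close> and \<open>y\<close> agree.\<close>
  have prob_TT: "measure_pmf.prob P (T x \<inter> T y) = Q\<^sup>2 / D {v\<in>V. x v = y v}"
    if xy: "x \<in> I" "y \<in> I" for x y
  proof -
    let ?U = "{v\<in>V. x v = y v}"
    have "image (\<phi> x) ` E \<inter> image (\<phi> y) ` E = image (\<phi> x) ` {e\<in>E. e \<subseteq> ?U}"
    proof (intro set_eqI iffI)
      fix S assume "S \<in> image (\<phi> x) ` E \<inter> image (\<phi> y) ` E"
      then obtain e e' where e: "e \<in> E" "e' \<in> E" "S = \<phi> x ` e" "\<phi> x ` e = \<phi> y ` e'" by auto
      hence "\<forall>v\<in>e. x v = y v"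
        using block_embed_image_eq_iff[OF ginj I[OF xy(1)] I[OF xy(2)], of e e'] E
        unfolding \<phi>_def by auto
      hence "e \<subseteq> ?U" using e(1) E by blast
      thus "S \<in> image (\<phi> x) ` {e\<in>E. e \<subseteq> ?U}" using e by blast
    next
      fix S assume "S \<in> image (\<phi> x) ` {e\<in>E. e \<subseteq> ?U}"
      then obtain e where e: "e \<in> E" "e \<subseteq> ?U" "S = \<phi> x ` e" by auto
      hence "\<phi> x ` e = \<phi> y ` e"
        using block_embed_image_eq_iff[OF ginj I[OF xy(1)] I[OF xy(2)], of e e] E
        unfolding \<phi>_def by auto
      thus "S \<in> image (\<phi> x) ` E \<inter> image (\<phi> y) ` E" using e by blast
    qed
    hence "(\<Prod>S\<in>image (\<phi> x) ` E \<inter> image (\<phi> y) ` E. \<pi> (card S)) = D ?U"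
      using prod_copy[OF xy(1), of "{e\<in>E. e \<subseteq> ?U}"] by (simp add: D_def)
    moreover have "(\<Prod>S\<in>image (\<phi> x) ` E \<union> image (\<phi> y) ` E. \<pi> (card S))
        * (\<Prod>S\<in>image (\<phi> x) ` E \<inter> image (\<phi> y) ` E. \<pi> (card S)) = Q * Q"
      using fE prod_copy xy by (subst prod.union_inter) (auto simp: Q_def)
    moreover have "T x \<inter> T y = {\<omega>. \<forall>S\<in>image (\<phi> x) ` E \<union> image (\<phi> y) ` E. trace_edge {1..n} W \<omega> S}"
      by (auto simp: T_def)
    ultimately show ?thesis
      using prob_tr[of "image (\<phi> x) ` E \<union> image (\<phi> y) ` E"] copy xy Dpos[of ?U]
      by (simp add: field_simps power2_eq_square)
  qed
  define \<mu> where "\<mu> = real (card I) * Q"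
  have \<mu>: "0 < \<mu>" using Qpos N by (simp add: \<mu>_def cardI)
  let ?S = "\<Sum>U\<in>Pow V - {{}}. 1 / (real N ^ card U * D U)"
  have "(\<Sum>x\<in>I. \<Sum>y\<in>I. measure_pmf.prob P (T x \<inter> T y)) \<le> (\<Sum>x\<in>I. real N ^ m * Q\<^sup>2 * (1 + ?S))"
  proof (rule sum_mono)
    fix x assume x: "x \<in> I"
    have "(\<Sum>y\<in>I. measure_pmf.prob P (T x \<inter> T y)) = (\<Sum>y\<in>I. Q\<^sup>2 / D {v\<in>V. x v = y v})"
      using prob_TT x by (intro sum.cong) auto
    \<comment> \<open>The placements \<open>y\<close> are grouped by the exact set on which they
      agree with \<open>x\<close>; each group is then bounded by all placements that agree at least
      there.\<close>
    also have "\<dots> = (\<Sum>U\<in>Pow V. \<Sum>y\<in>{y\<in>I. {v\<in>V. x v = y v} = U}. Q\<^sup>2 / D {v\<in>V. x v = y v})"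
      using fV finI by (intro sum.group[symmetric]) auto
    also have "\<dots> = (\<Sum>U\<in>Pow V. \<Sum>y\<in>{y\<in>I. {v\<in>V. x v = y v} = U}. Q\<^sup>2 / D U)"
      by (intro sum.cong) auto
    also have "\<dots> \<le> (\<Sum>U\<in>Pow V. real N ^ m * Q\<^sup>2 * (1 / (real N ^ card U * D U)))"
    proof (rule sum_mono)
      fix U assume U: "U \<in> Pow V"
      have "card {y\<in>I. {v\<in>V. x v = y v} = U} \<le> card {y\<in>V \<rightarrow>\<^sub>E {..<N}. \<forall>v\<in>U. x v = y v}"
        using finI by (intro card_mono) (auto simp: I_def)
      also have "\<dots> = N ^ (m - card U)"
        using card_PiE_agree[of V "{..<N}" U x] fV U x by (simp add: I_def m_def)
      finally have "real (card {y\<in>I. {v\<in>V. x v = y v} = U}) \<le> real (N ^ (m - card U))"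
        by (rule of_nat_mono)
      also have "\<dots> = real N ^ (m - card U)" by simp
      also have "\<dots> = real N ^ m / real N ^ card U"
        using N U fV by (intro power_diff) (auto simp: m_def intro: card_mono)
      finally have "real (card {y\<in>I. {v\<in>V. x v = y v} = U}) * (Q\<^sup>2 / D U)
          \<le> real N ^ m / real N ^ card U * (Q\<^sup>2 / D U)"
        using Dpos[of U] by (intro mult_right_mono) auto
      thus "(\<Sum>y\<in>{y\<in>I. {v\<in>V. x v = y v} = U}. Q\<^sup>2 / D U)
          \<le> real N ^ m * Q\<^sup>2 * (1 / (real N ^ card U * D U))"
        by (simp add: mult.commute)
    qed
    also have "\<dots> = real N ^ m * Q\<^sup>2 * (\<Sum>U\<in>Pow V. 1 / (real N ^ card U * D U))"
      by (simp add: sum_distrib_left)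
    \<comment> \<open>The empty set contributes exactly 1; this is the term that cancels against the
      squared mean.\<close>
    also have "(\<Sum>U\<in>Pow V. 1 / (real N ^ card U * D U)) = 1 + ?S"
      using fV by (subst sum.remove[of _ "{}"]) (auto simp: D_empty)
    finally show "(\<Sum>y\<in>I. measure_pmf.prob P (T x \<inter> T y)) \<le> real N ^ m * Q\<^sup>2 * (1 + ?S)" .
  qed
  also have "\<dots> = \<mu>\<^sup>2 * (1 + ?S)"
    by (simp add: \<mu>_def cardI power2_eq_square)
  finally have "measure_pmf.prob P {\<omega>. \<forall>x\<in>I. \<omega> \<notin> T x} * \<mu>\<^sup>2 \<le> ?S * \<mu>\<^sup>2"
    using prob_eq_zero_le_second_moment[OF finI, of P T Q] prob_T by (simp add: \<mu>_def algebra_simps)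
  hence none: "measure_pmf.prob P {\<omega>. \<forall>x\<in>I. \<omega> \<notin> T x} \<le> ?S"
    using \<mu> by simp
  have "measure_pmf.prob (random_hypergraph n q) {G. \<not> contains_weakly G H}
      = measure_pmf.prob P {\<omega>. \<not> contains_weakly ({1..n}, {e. \<omega> e}) H}"
    by (simp add: random_hypergraph_def P_def vimage_def)
  also have "\<dots> \<le> measure_pmf.prob P {\<omega>. \<forall>x\<in>I. \<omega> \<notin> T x}"
  proof (rule measure_pmf.finite_measure_mono)
    show "{\<omega>. \<not> contains_weakly ({1..n}, {e. \<omega> e}) H} \<subseteq> {\<omega>. \<forall>x\<in>I. \<omega> \<notin> T x}"
    proof (intro subsetI CollectI ballI notI)
      fix \<omega> x assume no: "\<omega> \<in> {\<omega>. \<not> contains_weakly ({1..n}, {e. \<omega> e}) H}"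
        and x: "x \<in> I" "\<omega> \<in> T x"
      have "contains_weakly ({1..n}, {e. \<omega> e}) H"
        using traces_imp_contains_weakly[OF H, of "\<phi> x" W "{1..n}" \<omega>] \<phi>inj[OF x(1)] \<phi>W[OF x(1)] W(1) x(2)
        by (auto simp: T_def V_def E_def)
      thus False using no by simp
    qed
  qed auto
  also note none
  finally show ?thesis by (simp add: D_def \<pi>_def m_def V_def E_def)
qed

section \<open>Asymptotics and the two statements\<close>

text \<open>Capping every factor at \<open>1\<close> amounts to dropping, separately for each \<open>n\<close>, the edges
  with \<open>p'\<^sub>r > 1\<close>; finitely many strong subgraphs arise this way.\<close>

lemma capped_mu_w_at_top:
  assumes H: "hypergraph H" "\<forall>e\<in>edges H. card e \<in> {1..M}" and U: "U \<subseteq> verts H" "U \<noteq> {}"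
    and lim: "\<And>H'. strong_subgraph H' H \<Longrightarrow> verts H' \<noteq> {} \<Longrightarrow>
      filterlim (mu_w M p H') at_top sequentially"
  shows "filterlim (\<lambda>n. real n ^ card U *
           (\<Prod>e\<in>{e\<in>edges H. e \<subseteq> U}. min 1 (p_prime M p (card e) n))) at_top sequentially"
  unfolding filterlim_at_top
proof
  fix Z :: real
  define F where "F = {e\<in>edges H. e \<subseteq> U}"
  have finE: "finite (edges H)" using H by (auto simp: hypergraph_def intro: finite_subset)
  hence finF: "finite F" by (simp add: F_def)
  have sub: "strong_subgraph (U, D) H" if "D \<subseteq> F" for D
    using that H U by (auto simp: strong_subgraph_def hypergraph_def F_def intro: finite_subset)
  \<comment> \<open>One threshold for all \<open>D\<close> at once, because the set \<open>D\<close>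
    chosen below changes with \<open>n\<close>.\<close>
  have "\<forall>\<^sub>F n in sequentially. \<forall>D\<in>Pow F. Z \<le> mu_w M p (U, D) n"
  proof (rule eventually_ball_finite, simp add: finF, rule ballI)
    fix D assume "D \<in> Pow F"
    hence "filterlim (mu_w M p (U, D)) at_top sequentially" using lim sub U by auto
    thus "\<forall>\<^sub>F n in sequentially. Z \<le> mu_w M p (U, D) n" by (simp add: filterlim_at_top)
  qed
  thus "\<forall>\<^sub>F n in sequentially. Z \<le> real n ^ card U *
           (\<Prod>e\<in>{e\<in>edges H. e \<subseteq> U}. min 1 (p_prime M p (card e) n))"
  proof eventually_elim
    case (elim n)
    define D where "D = {e\<in>F. p_prime M p (card e) n \<le> 1}"
    have D: "D \<subseteq> F" by (auto simp: D_def)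
    have "{e\<in>D. card e \<in> {1..M}} = D" using H(2) by (auto simp: D_def F_def)
    hence "mu_w M p (U, D) n = real n ^ card U * (\<Prod>e\<in>D. p_prime M p (card e) n)"
      using sub[OF D] by (subst mu_w_eq_prod_edges) (auto simp: strong_subgraph_def)
    also have "(\<Prod>e\<in>D. p_prime M p (card e) n) = (\<Prod>e\<in>D. min 1 (p_prime M p (card e) n))"
      by (intro prod.cong) (auto simp: D_def)
    also have "\<dots> = (\<Prod>e\<in>F. min 1 (p_prime M p (card e) n))"
      using finF by (intro prod.mono_neutral_left) (auto simp: D_def)
    finally show ?case using bspec[OF elim, of D] D by (simp add: F_def)
  qed
qed

lemma aas_iff: "aas X P \<longleftrightarrow> (\<lambda>n. measure_pmf.prob (X n) {x. \<not> P x}) \<longlonglongrightarrow> 0"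
proof -
  have eq: "measure_pmf.prob (X n) {x. P x} = 1 - measure_pmf.prob (X n) {x. \<not> P x}" for n
    using measure_pmf.prob_compl[of "{x. \<not> P x}" "X n"] by (simp add: set_diff_eq)
  show ?thesis
  proof
    assume "aas X P"
    hence "(\<lambda>n. 1 - measure_pmf.prob (X n) {x. P x}) \<longlonglongrightarrow> 1 - 1"
      unfolding aas_def by (intro tendsto_intros)
    thus "(\<lambda>n. measure_pmf.prob (X n) {x. \<not> P x}) \<longlonglongrightarrow> 0" by (simp add: eq)
  next
    assume "(\<lambda>n. measure_pmf.prob (X n) {x. \<not> P x}) \<longlonglongrightarrow> 0"
    hence "(\<lambda>n. 1 - measure_pmf.prob (X n) {x. \<not> P x}) \<longlonglongrightarrow> 1 - 0"
      by (intro tendsto_intros)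
    thus "aas X P" unfolding aas_def eq by simp
  qed
qed

text \<open>With blocks of length n div (m + 1), the window and its complement both have linear size
  when \<open>H\<close> has vertices. Each denominator in the second moment bound is then eventually
  at least a constant times a capped \<open>mu_w\<close>, so the finite sum tends to 0.\<close>

lemma aas_contains_weakly:
  assumes p: "bounded_seq M p" and H: "hypergraph H" "\<forall>e\<in>edges H. card e \<in> {1..M}"
    and lim: "\<And>H'. strong_subgraph H' H \<Longrightarrow> verts H' \<noteq> {} \<Longrightarrow>
      filterlim (mu_w M p H') at_top sequentially"
  shows "aas (\<lambda>n. random_hypergraph n (\<lambda>r. p r n)) (\<lambda>G. contains_weakly G H)"
proof -
  define m where "m = card (verts H)"
  define N where "N n = n div (m + 1)" for n
  define \<pi> where "\<pi> n = trace_prob (\<lambda>r. p r n) (n - m * N n)" for n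
  define D where "D U n = real (N n) ^ card U * (\<Prod>e\<in>{e\<in>edges H. e \<subseteq> U}. \<pi> n (card e))" for U n
  \<comment> \<open>From n = (m + 1) N + remainder and remainder \<le> m \<le> N follows n \<le> (m
    + 2) N. The constant \<open>c\<close> is the one in
    \<open>trace_prob_ge_p_prime\<close>.\<close>
  define C where "C = real (m + 2)"
  define c where "c = (1 / (C * M)) ^ M / 2"
  have C: "1 \<le> C" by (simp add: C_def)
  \<comment> \<open>For \<open>M = 0\<close> the quotient is 0 by convention, but the exponent 0
    makes \<open>c\<close> equal to 1 / 2.\<close>
  have c: "0 < c" using C by (cases "M = 0") (auto simp: c_def)
  have p01: "0 \<le> p r n \<and> p r n \<le> 1" if "r \<ge> 1" for r n using bounded_seq_prob[OF p that] .
  have fV: "finite (verts H)" and ne: "{} \<notin> edges H" using H by (auto simp: hypergraph_def)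
  have \<pi>_nonneg: "0 \<le> \<pi> n (card e)" if "e \<in> edges H" for e n
    unfolding \<pi>_def using p01 H(2) that by (intro trace_prob_bounds(1)) auto
  have large: "\<forall>\<^sub>F n in sequentially. M \<le> N n \<and> m \<le> N n \<and> 1 \<le> N n"
  proof (rule eventually_sequentiallyI[of "(M + m + 1) * (m + 1)"])
    fix n assume "(M + m + 1) * (m + 1) \<le> n"
    hence "(M + m + 1) * (m + 1) div (m + 1) \<le> N n" unfolding N_def by (rule div_le_mono)
    moreover have "(M + m + 1) * (m + 1) div (m + 1) = M + m + 1" by (rule nonzero_mult_div_cancel_right) simp
    ultimately show "M \<le> N n \<and> m \<le> N n \<and> 1 \<le> N n" by linarith
  qed
  have N: "m * N n + N n \<le> n" for n
    using div_times_less_eq_dividend[of n "m + 1"] by (simp add: N_def algebra_simps)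
  have NC: "real n \<le> C * N n" if "m \<le> N n" for n
  proof -
    have "n = (m + 1) * N n + n mod (m + 1)" unfolding N_def by (rule mult_div_mod_eq[symmetric])
    moreover have "n mod (m + 1) \<le> m" using mod_less_divisor[of "m + 1" n] by simp
    ultimately have "n \<le> (m + 1) * N n + N n" using that by linarith
    hence "real n \<le> real ((m + 1) * N n + N n)" by (simp only: of_nat_le_iff)
    thus ?thesis by (simp add: C_def algebra_simps)
  qed
  have D_lim: "filterlim (D U) at_top sequentially" if U: "U \<subseteq> verts H" "U \<noteq> {}" for U
  proof -
    let ?F = "{e\<in>edges H. e \<subseteq> U}"
    \<comment> \<open>Each edge inside \<open>U\<close> loses a factor \<open>c\<close>, and each
      vertex a factor \<open>C\<close> in passing from \<open>n\<close> to
      \<open>N n\<close>.\<close>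
    define K where "K = c ^ card ?F / C ^ card U"
    have "0 < K" using c C by (simp add: K_def)
    hence "filterlim (\<lambda>n. K * (real n ^ card U * (\<Prod>e\<in>?F. min 1 (p_prime M p (card e) n)))) at_top sequentially"
      using capped_mu_w_at_top[OF H U lim]
      by (intro filterlim_tendsto_pos_mult_at_top[OF tendsto_const]) auto
    moreover have "\<forall>\<^sub>F n in sequentially.
        K * (real n ^ card U * (\<Prod>e\<in>?F. min 1 (p_prime M p (card e) n))) \<le> D U n"
      using large
    proof eventually_elim
      case (elim n)
      have b: "N n \<le> n - m * N n" using N[of n] by simp
      have "real n \<le> C * real (N n)" using NC elim by blast
      also have "\<dots> \<le> C * real (n - m * N n)" using C b by (intro mult_left_mono) auto
      finally have nb: "real n \<le> C * real (n - m * N n)" .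
      have "(real n / C) ^ card U \<le> real (N n) ^ card U"
        using NC[of n] elim C by (intro power_mono) (auto simp: field_simps)
      moreover have "(\<Prod>e\<in>?F. c * min 1 (p_prime M p (card e) n)) \<le> (\<Prod>e\<in>?F. \<pi> n (card e))"
      proof (rule prod_mono)
        fix e assume "e \<in> ?F"
        hence e: "card e \<in> {1..M}" using H(2) by auto
        have "c * min 1 (p_prime M p (card e) n) \<le> \<pi> n (card e)"
          unfolding \<pi>_def c_def using elim b nb C by (intro trace_prob_ge_p_prime[OF p e]) auto
        thus "0 \<le> c * min 1 (p_prime M p (card e) n) \<and> c * min 1 (p_prime M p (card e) n) \<le> \<pi> n (card e)"
          using c p_prime_nonneg[OF p, of "card e" n] e by simp
      qed
      ultimately have "(real n / C) ^ card U * (\<Prod>e\<in>?F. c * min 1 (p_prime M p (card e) n)) \<le> D U n"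
        unfolding D_def using c p_prime_nonneg[OF p] H(2)
        by (intro mult_mono) (auto intro!: prod_nonneg mult_nonneg_nonneg)
      thus ?case by (simp add: K_def prod.distrib power_divide mult_ac)
    qed
    ultimately show ?thesis by (rule filterlim_at_top_mono)
  qed
  \<comment> \<open>As \<open>D e\<close> tends to infinity and has the trace probability of
    \<open>e\<close> among its factors, that factor is eventually nonzero.\<close>
  have pos: "\<forall>\<^sub>F n in sequentially. \<forall>e\<in>edges H. 0 < \<pi> n (card e)"
  proof (rule eventually_ball_finite)
    show "finite (edges H)" using H by (auto simp: hypergraph_def intro: finite_subset)
    show "\<forall>e\<in>edges H. \<forall>\<^sub>F n in sequentially. 0 < \<pi> n (card e)"
    proof
      fix e assume e: "e \<in> edges H"
      hence "filterlim (D e) at_top sequentially"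
        using H ne by (intro D_lim) (auto simp: hypergraph_def)
      hence "\<forall>\<^sub>F n in sequentially. 0 < D e n" by (simp add: filterlim_at_top_dense)
      thus "\<forall>\<^sub>F n in sequentially. 0 < \<pi> n (card e)"
      proof eventually_elim
        case (elim n)
        have "finite {e'\<in>edges H. e' \<subseteq> e}" using \<open>finite (edges H)\<close> by simp
        moreover have "(\<Prod>e'\<in>{e'\<in>edges H. e' \<subseteq> e}. \<pi> n (card e')) \<noteq> 0"
          using elim unfolding D_def by (metis less_irrefl mult_zero_right)
        ultimately have "\<pi> n (card e) \<noteq> 0" using e by (simp only: prod_zero_iff) blast
        thus ?case using \<pi>_nonneg[OF e, of n] by simp
      qed
    qed
  qed
  have "(\<lambda>n. measure_pmf.prob (random_hypergraph n (\<lambda>r. p r n)) {G. \<not> contains_weakly G H}) \<longlonglongrightarrow> 0"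
  proof (rule tendsto_sandwich[OF _ _ tendsto_const])
    show "(\<lambda>n. \<Sum>U\<in>Pow (verts H) - {{}}. 1 / D U n) \<longlonglongrightarrow> 0"
      using D_lim by (intro tendsto_null_sum tendsto_divide_0[OF tendsto_const] filterlim_at_top_imp_at_infinity) auto
    show "\<forall>\<^sub>F n in sequentially.
        measure_pmf.prob (random_hypergraph n (\<lambda>r. p r n)) {G. \<not> contains_weakly G H}
        \<le> (\<Sum>U\<in>Pow (verts H) - {{}}. 1 / D U n)"
      using large pos
    proof eventually_elim
      case (elim n)
      show ?case
        unfolding D_def \<pi>_def m_def
        using elim N[of n] p01 by (intro prob_not_contains_weakly_le[OF H(1) ne]) (auto simp: \<pi>_def m_def)
    qed
  qed auto
  thus ?thesis by (simp add: aas_iff)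
qed

text \<open>On the empty vertex set \<open>mu_w\<close> is constantly 1, so the divergence in the
  second part concerns nonempty vertex sets. Edges of size 0 or above \<open>M\<close> are invisible
  to \<open>mu_w\<close> but almost surely prevent a weak copy: weak subgraphs have no empty edge,
  and no random edge has more than \<open>M\<close> vertices.\<close>

theorem theorem3p3:
  fixes H :: "'a hypergraph" and M :: nat and p :: "nat \<Rightarrow> nat \<Rightarrow> real"
    and J :: "'a hypergraph set"
  assumes "hypergraph H"
    and "bounded_seq M p"
    and "J = {H'. strong_subgraph H' H}"
  shows "((\<exists>H'\<in>J. mu_w M p H' \<longlonglongrightarrow> 0) \<longrightarrow>
           aas (\<lambda>n. random_hypergraph n (\<lambda>r. p r n)) (\<lambda>G. \<not> contains_weakly G H))
       \<and> ((\<forall>e\<in>edges H. card e \<in> {1..M}) \<and>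
          (\<forall>H'\<in>J. verts H' \<noteq> {} \<longrightarrow> filterlim (mu_w M p H') at_top sequentially) \<longrightarrow>
           aas (\<lambda>n. random_hypergraph n (\<lambda>r. p r n)) (\<lambda>G. contains_weakly G H))"
proof (intro conjI impI)
  assume "\<exists>H'\<in>J. mu_w M p H' \<longlonglongrightarrow> 0"
  then obtain H' where H': "strong_subgraph H' H" "mu_w M p H' \<longlonglongrightarrow> 0" using assms(3) by auto
  have "(\<lambda>n. measure_pmf.prob (random_hypergraph n (\<lambda>r. p r n)) {G. contains_weakly G H}) \<longlonglongrightarrow> 0"
    by (rule tendsto_sandwich[OF _ _ tendsto_const H'(2)])
      (auto simp: prob_contains_weakly_le_mu_w[OF assms(2) H'(1)])
  thus "aas (\<lambda>n. random_hypergraph n (\<lambda>r. p r n)) (\<lambda>G. \<not> contains_weakly G H)"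
    by (simp add: aas_iff)
next
  assume hyps: "(\<forall>e\<in>edges H. card e \<in> {1..M}) \<and>
    (\<forall>H'\<in>J. verts H' \<noteq> {} \<longrightarrow> filterlim (mu_w M p H') at_top sequentially)"
  show "aas (\<lambda>n. random_hypergraph n (\<lambda>r. p r n)) (\<lambda>G. contains_weakly G H)"
  proof (rule aas_contains_weakly[OF assms(2,1)])
    show "filterlim (mu_w M p H') at_top sequentially"
      if "strong_subgraph H' H" "verts H' \<noteq> {}" for H'
      using hyps that assms(3) by blast
  qed (use hyps in blast)
qed

end
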